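(* Let $h\ge 1$, assume $\boldsymbol{\gamma}_{h-1}$ and $\boldsymbol{\gamma}_h$ are linearly independent vectors in $\mathbb{R}^L$, and let $\beta_h\in\mathbb{R}$. Then the solution of $$\min_{\mathbf{b}\in\mathbb{R}^L}\ (\boldsymbol{\gamma}_h-\mathbf{b})'(\boldsymbol{\gamma}_h-\mathbf{b})\quad\text{subject to}\quad (\boldsymbol{\gamma}_{h-1}-\boldsymbol{\gamma}_h)'\mathbf{b}=\beta_h$$ is $$\mathbf{b}=\boldsymbol{\gamma}_h+\lambda(\boldsymbol{\gamma}_{h-1}-\boldsymbol{\gamma}_h),\qquad \lambda=\frac{\beta_h-\boldsymbol{\gamma}_h'(\boldsymbol{\gamma}_{h-1}-\boldsymbol{\gamma}_h)}{(\boldsymbol{\gamma}_{h-1}-\boldsymbol{\gamma}_h)'(\boldsymbol{\gamma}_{h-1}-\boldsymbol{\gamma}_h)} .$$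
   Context: $(\gamma_k)_{k\in\mathbb{Z}}$ is a square-summable real sequence, $L\ge 1$ is an integer, and for each integer $h\ge 0$, $\boldsymbol{\gamma}_h:=(\gamma_h,\gamma_{h+1},\dots,\gamma_{h+L-1})'\in\mathbb{R}^L$. A prime denotes transposition. *)

theory Defs
  imports "HOL-Analysis.Infinite_Sum" "Jordan_Normal_Form.VS_Connect"
begin

definition gamma_vec :: "(int \<Rightarrow> real) \<Rightarrow> nat \<Rightarrow> nat \<Rightarrow> real vec" where
  "gamma_vec \<gamma> L h = vec L (\<lambda>i. \<gamma> (int h + int i))"

(* lin_dep speaks about sets, so for u = v it would only see one vector;
   linear independence of two vectors requires them to be distinct as well. *)
definition lin_indpt_pair :: "nat \<Rightarrow> real vec \<Rightarrow> real vec \<Rightarrow> bool" where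
  "lin_indpt_pair L u v \<longleftrightarrow>
     u \<noteq> v \<and> \<not> LinearCombinations.module.lin_dep class_ring (module_vec TYPE(real) L) {u, v}"

end

(* The candidate c lies on the line through g with direction d, hence for feasible b the vector
   b - c is orthogonal to d and so to g - c. By Pythagoras the objective at b exceeds the
   objective at c by the squared length of b - c. *)
theory Submission
  imports Defs
begin

text \<open>Conjugation is the identity on the reals, so definiteness of the conjugate scalar
  product applies.\<close>

lemma scalar_prod_self_eq_0_iff:
  fixes v :: "real vec"
  assumes "v \<in> carrier_vec n"
  shows "v \<bullet> v = 0 \<longleftrightarrow> v = 0\<^sub>v n"
  using conjugate_square_eq_0_vec[OF assms] by simp

lemma minus_vec_eq_0_iff:
  fixes u v :: "real vec"
  assumes "u \<in> carrier_vec n" "v \<in> carrier_vec n"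
  shows "u - v = 0\<^sub>v n \<longleftrightarrow> u = v"
  using assms by (auto simp: vec_eq_iff)

text \<open>Feasibility is a comparison with the point \<open>c\<close>, so the identity holds for
  any multiplier \<open>t\<close> and involves no division.\<close>

lemma pythagoras_hyperplane:
  fixes g d b :: "real vec" and t :: real
  assumes carrier: "g \<in> carrier_vec n" "d \<in> carrier_vec n" "b \<in> carrier_vec n"
    and feasible: "d \<bullet> b = d \<bullet> (g + t \<cdot>\<^sub>v d)"
  defines "c \<equiv> g + t \<cdot>\<^sub>v d"
  shows "(g - b) \<bullet> (g - b) = (g - c) \<bullet> (g - c) + (b - c) \<bullet> (b - c)"
proof -
  define e where "e = b - c"
  have c: "c \<in> carrier_vec n" and e: "e \<in> carrier_vec n"
    using carrier by (auto simp: c_def e_def)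
  have de: "d \<bullet> e = 0"
    using feasible carrier c unfolding e_def
    by (simp add: scalar_prod_minus_distrib c_def)
  \<comment> \<open>\<open>g\<close> cancels from \<open>g - c\<close>, and \<open>g - b\<close> is
    \<open>(g - c) - (b - c)\<close>; both cross terms of its square are thus multiples of the
    vanishing products of \<open>d\<close> and \<open>e\<close>.\<close>
  have gc: "g - c = (- t) \<cdot>\<^sub>v d" and gb: "g - b = (- t) \<cdot>\<^sub>v d - e"
    using carrier by (auto simp: c_def e_def)
  have ed: "e \<bullet> d = 0"
    using de comm_scalar_prod[OF carrier(2) e] by simp
  have "((- t) \<cdot>\<^sub>v d - e) \<bullet> ((- t) \<cdot>\<^sub>v d - e)
      = ((- t) \<cdot>\<^sub>v d) \<bullet> ((- t) \<cdot>\<^sub>v d) + e \<bullet> e"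
    using carrier e de ed
    by (simp add: scalar_prod_minus_distrib[of _ n] minus_scalar_prod_distrib[of _ n])
  then show ?thesis
    by (simp add: gc gb e_def)
qed

text \<open>Equating the set of minimisers with a singleton captures existence and uniqueness at
  once.\<close>

lemma argmin_distance_hyperplane:
  fixes g d :: "real vec" and \<beta> :: real
  assumes g: "g \<in> carrier_vec n" and d: "d \<in> carrier_vec n" and d0: "d \<noteq> 0\<^sub>v n"
  shows "{b. is_arg_min (\<lambda>b. (g - b) \<bullet> (g - b)) (\<lambda>b. b \<in> carrier_vec n \<and> d \<bullet> b = \<beta>) b}
       = {g + ((\<beta> - g \<bullet> d) / (d \<bullet> d)) \<cdot>\<^sub>v d}" (is "_ = {?c}")
proof -
  have c: "?c \<in> carrier_vec n" using g d by simp
  \<comment> \<open>The multiplier in \<open>?c\<close> is the root \<open>t\<close> of the linear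
    equation \<open>g \<bullet> d + t * (d \<bullet> d) = \<beta>\<close>, which needs a nonzero
    leading coefficient.\<close>
  have "d \<bullet> d \<noteq> 0" using scalar_prod_self_eq_0_iff[OF d] d0 by simp
  then have dc: "d \<bullet> ?c = \<beta>"
    using g d by (simp add: scalar_prod_add_distrib[of _ n] comm_scalar_prod[of d n g])
  have pyth: "(g - b) \<bullet> (g - b) = (g - ?c) \<bullet> (g - ?c) + (b - ?c) \<bullet> (b - ?c)"
    if "b \<in> carrier_vec n" "d \<bullet> b = \<beta>" for b
    using pythagoras_hyperplane[OF g d that(1)] dc that(2) by simp
  have pos: "(b - ?c) \<bullet> (b - ?c) \<ge> 0" for b
    by (simp add: scalar_prod_def sum_nonneg)
  have min_iff: "is_arg_min (\<lambda>b. (g - b) \<bullet> (g - b))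
      (\<lambda>b. b \<in> carrier_vec n \<and> d \<bullet> b = \<beta>) b \<longleftrightarrow> b = ?c" for b
  proof
    assume "is_arg_min (\<lambda>b. (g - b) \<bullet> (g - b)) (\<lambda>b. b \<in> carrier_vec n \<and> d \<bullet> b = \<beta>) b"
    then have b: "b \<in> carrier_vec n" "d \<bullet> b = \<beta>"
      and "(g - b) \<bullet> (g - b) \<le> (g - ?c) \<bullet> (g - ?c)"
      using c dc by (auto simp: is_arg_min_linorder)
    \<comment> \<open>A minimiser does no worse than the feasible \<open>?c\<close>, so the excess
      in \<open>pyth\<close> is at most zero.\<close>
    then have "(b - ?c) \<bullet> (b - ?c) = 0"
      using pyth[OF b] pos[of b] by linarith
    then show "b = ?c"
      using scalar_prod_self_eq_0_iff[of "b - ?c" n] minus_vec_eq_0_iff[OF b(1) c] b c by simp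
  next
    assume "b = ?c"
    moreover have "(g - ?c) \<bullet> (g - ?c) \<le> (g - x) \<bullet> (g - x)"
      if "x \<in> carrier_vec n" "d \<bullet> x = \<beta>" for x
      using pyth[OF that] pos[of x] by linarith
    ultimately show "is_arg_min (\<lambda>b. (g - b) \<bullet> (g - b))
        (\<lambda>b. b \<in> carrier_vec n \<and> d \<bullet> b = \<beta>) b"
      using c dc by (simp add: is_arg_min_linorder)
  qed
  then show ?thesis by auto
qed

text \<open>This is the projection onto a hyperplane with normal \<open>d\<close>. Since
  \<open>h \<ge> 1\<close>, the natural number \<open>h - 1\<close> is the true predecessor.\<close>

theorem mainTheorem7:
  fixes \<gamma> :: "int \<Rightarrow> real" and L h :: nat and \<beta>\<^sub>h :: real
  defines "g \<equiv> gamma_vec \<gamma> L h"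
    and "d \<equiv> gamma_vec \<gamma> L (h - 1) - gamma_vec \<gamma> L h"
  assumes "(\<lambda>k. (\<gamma> k)\<^sup>2) summable_on UNIV"
    and "L \<ge> 1"
    and "h \<ge> 1"
    and "lin_indpt_pair L (gamma_vec \<gamma> L (h - 1)) (gamma_vec \<gamma> L h)"
  shows "{b. is_arg_min (\<lambda>b. (g - b) \<bullet> (g - b)) (\<lambda>b. b \<in> carrier_vec L \<and> d \<bullet> b = \<beta>\<^sub>h) b}
       = {g + ((\<beta>\<^sub>h - g \<bullet> d) / (d \<bullet> d)) \<cdot>\<^sub>v d}"
proof -
  have carrier: "gamma_vec \<gamma> L k \<in> carrier_vec L" for k
    by (simp add: gamma_vec_def)
  \<comment> \<open>Independent vectors are distinct, so their difference \<open>d\<close> is a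
    genuine normal vector.\<close>
  have "gamma_vec \<gamma> L (h - 1) \<noteq> gamma_vec \<gamma> L h"
    using assms(6) by (simp add: lin_indpt_pair_def)
  then have "d \<noteq> 0\<^sub>v L"
    unfolding d_def using minus_vec_eq_0_iff[OF carrier carrier] by simp
  then show ?thesis
    by (intro argmin_distance_hyperplane) (auto simp: g_def d_def carrier)
qed

end
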